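(* Let $n\ge 6$ and $r_n=0^{n-4}1011$. For every $\alpha\in\mathbf{A}(n)\setminus\{r_n\}$ define $$\mathrm{par}(\alpha)=\begin{cases}\mathrm{FirstOne}(\alpha) & \text{if }\mathrm{FirstOne}(\alpha)\in\mathbf{A}(n),\\ \mathrm{LastOne}(\alpha) & \text{if }\mathrm{FirstOne}(\alpha)\notin\mathbf{A}(n)\text{ and }\mathrm{LastOne}(\alpha)\in\mathbf{A}(n),\\ \mathrm{LastZero}(\alpha) & \text{otherwise.}\end{cases}$$ Then $\mathrm{par}(\alpha)\in\mathbf{A}(n)$ for every $\alpha\in\mathbf{A}(n)\setminus\{r_n\}$, and the graph on vertex set $\mathbf{A}(n)$ with edges $\{\alpha,\mathrm{par}(\alpha)\}$ is a tree rooted at $r_n$ (every $\alpha$ reaches $r_n$ by iterating $\mathrm{par}$), and this tree has height less than $2(n-4)$.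
   Context: Binary strings are compared lexicographically with $0<1$ (a proper prefix is smaller). For $\alpha=a_1\cdots a_n$, $\alpha^R=a_n\cdots a_1$. $[\alpha]$ is the set of rotations of $\alpha$; $\alpha$ is a necklace if it is lexicographically smallest in $[\alpha]$, and a bracelet if lexicographically smallest in $[\alpha]\cup[\alpha^R]$. A necklace $\alpha$ is symmetric if $\alpha^R\in[\alpha]$, otherwise asymmetric. $\mathbf{A}(n)$ is the set of length-$n$ asymmetric bracelets (bracelets that are not symmetric); every element begins with $0$ and ends with $1$. For $\alpha=a_1\cdots a_n\in\mathbf{A}(n)$: $\mathrm{FirstOne}(\alpha)$ is $\alpha$ with its first $1$ flipped to $0$; $\mathrm{LastOne}(\alpha)$ is the necklace (lexicographically smallest rotation) of $a_1\cdots a_{n-1}0$; $\mathrm{LastZero}(\alpha)$ is $\alpha$ with its last $0$ flipped to $1$. *)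

theory Defs
  imports Main "HOL-Library.List_Lexorder"
begin

text \<open>
  Binary strings are lists of type \<^typ>\<open>bool list\<close>, where \<^term>\<open>False\<close> is the bit 0 and \<^term>\<open>True\<close>
  is the bit 1; the order on them is the lexicographic one of \<^theory>\<open>HOL-Library.List_Lexorder\<close>,
  in which a proper prefix is smaller.
\<close>

definition rotations :: "'a list \<Rightarrow> 'a list set" where
  "rotations xs = {rotate k xs | k. True}"

lemma finite_rotations [simp]: "finite (rotations xs)"
  by (rule finite_subset[OF _ finite_lists_length_eq[of "set xs" "length xs"]])
    (auto simp: rotations_def)

definition is_bracelet :: "bool list \<Rightarrow> bool" where
  "is_bracelet \<alpha> \<longleftrightarrow> (\<forall>\<beta> \<in> rotations \<alpha> \<union> rotations (rev \<alpha>). \<alpha> \<le> \<beta>)"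

definition is_symmetric :: "bool list \<Rightarrow> bool" where
  "is_symmetric \<alpha> \<longleftrightarrow> rev \<alpha> \<in> rotations \<alpha>"

definition asym_bracelets :: "nat \<Rightarrow> bool list set" where
  "asym_bracelets n = {\<alpha>. length \<alpha> = n \<and> is_bracelet \<alpha> \<and> \<not> is_symmetric \<alpha>}"

definition necklace_of :: "bool list \<Rightarrow> bool list" where
  "necklace_of \<alpha> = Min (rotations \<alpha>)"

definition first_one :: "bool list \<Rightarrow> bool list" where
  "first_one \<alpha> = \<alpha>[(LEAST i. i < length \<alpha> \<and> \<alpha> ! i) := False]"

definition last_one :: "bool list \<Rightarrow> bool list" where
  "last_one \<alpha> = necklace_of (butlast \<alpha> @ [False])"

definition last_zero :: "bool list \<Rightarrow> bool list" where
  "last_zero \<alpha> = \<alpha>[(GREATEST i. i < length \<alpha> \<and> \<not> \<alpha> ! i) := True]"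

definition root_string :: "nat \<Rightarrow> bool list" where
  "root_string n = replicate (n - 4) False @ [True, False, True, True]"

definition par :: "nat \<Rightarrow> bool list \<Rightarrow> bool list" where
  "par n \<alpha> =
     (if first_one \<alpha> \<in> asym_bracelets n then first_one \<alpha>
      else if last_one \<alpha> \<in> asym_bracelets n then last_one \<alpha>
      else last_zero \<alpha>)"

text \<open>
  Finite simple undirected graphs, given by a vertex set \<open>V\<close> and a set \<open>E\<close> of two-element
  subsets of \<open>V\<close>. Walks and cycles are lists of vertices, so a walk with \<open>k\<close> edges has length
  \<open>k + 1\<close>; the closing edge of a cycle joins its last vertex to its first.
\<close>

definition simple_graph :: "'a set \<Rightarrow> 'a set set \<Rightarrow> bool" where
  "simple_graph V E \<longleftrightarrow> finite V \<and> (\<forall>e \<in> E. e \<subseteq> V \<and> card e = 2)"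

definition walk_betw :: "'a set \<Rightarrow> 'a set set \<Rightarrow> 'a \<Rightarrow> 'a list \<Rightarrow> 'a \<Rightarrow> bool" where
  "walk_betw V E u p v \<longleftrightarrow>
     p \<noteq> [] \<and> set p \<subseteq> V \<and> hd p = u \<and> last p = v \<and> successively (\<lambda>x y. {x, y} \<in> E) p"

definition connected_graph :: "'a set \<Rightarrow> 'a set set \<Rightarrow> bool" where
  "connected_graph V E \<longleftrightarrow> V \<noteq> {} \<and> (\<forall>u \<in> V. \<forall>v \<in> V. \<exists>p. walk_betw V E u p v)"

definition is_cycle :: "'a set \<Rightarrow> 'a set set \<Rightarrow> 'a list \<Rightarrow> bool" where
  "is_cycle V E c \<longleftrightarrow>
     length c \<ge> 3 \<and> distinct c \<and> set c \<subseteq> V \<and>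
     successively (\<lambda>x y. {x, y} \<in> E) c \<and> {last c, hd c} \<in> E"

definition is_tree :: "'a set \<Rightarrow> 'a set set \<Rightarrow> bool" where
  "is_tree V E \<longleftrightarrow> simple_graph V E \<and> connected_graph V E \<and> (\<nexists>c. is_cycle V E c)"

definition rooted_tree :: "'a set \<Rightarrow> 'a set set \<Rightarrow> 'a \<Rightarrow> bool" where
  "rooted_tree V E r \<longleftrightarrow> is_tree V E \<and> r \<in> V"

definition graph_dist :: "'a set \<Rightarrow> 'a set set \<Rightarrow> 'a \<Rightarrow> 'a \<Rightarrow> nat" where
  "graph_dist V E u v = (LEAST k. \<exists>p. walk_betw V E u p v \<and> length p = k + 1)"

definition tree_height :: "'a set \<Rightarrow> 'a set set \<Rightarrow> 'a \<Rightarrow> nat" where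
  "tree_height V E r = Max (graph_dist V E r ` V)"

definition par_edges :: "nat \<Rightarrow> bool list set set" where
  "par_edges n = {{\<alpha>, par n \<alpha>} | \<alpha>. \<alpha> \<in> asym_bracelets n - {root_string n}}"

end

theory Submission
  imports Defs
begin

text \<open>
  Write an asymmetric bracelet as \<open>0\<^sup>z 1 0\<^sup>p v 0\<^sup>q 1\<close> with \<open>v\<close> beginning and ending in 1. Its zero
  runs have length at most \<open>z\<close>, so FirstOne and LastOne produce the strings
  \<open>0\<^bsup>z+1+p\<^esup> v 0\<^sup>q 1\<close> and \<open>0\<^bsup>z+1+q\<^esup> 1 0\<^sup>p v\<close>, whose initial zero run is the unique longest one. A string
  \<open>0\<^sup>m w\<close> of this kind is a necklace, and it is an asymmetric bracelet as soon as \<open>w < w\<^sup>R\<close>.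
  If both fail, then \<open>q < p\<close>, and comparing the two failed inequalities with the minimality of the
  bracelet shows that LastZero yields an asymmetric bracelet with the same \<open>z\<close> to which
  LastOne applies successfully. Hence \<open>z\<close> grows at least once in every two steps; since
  \<open>1 \<le> z \<le> n - 4\<close> with \<open>z = n - 4\<close> only for the root, at most \<open>2(n - 5)\<close> steps are needed.
\<close>

subsection \<open>Lexicographic comparison and zero runs\<close>

lemma append_less_append_iff:
  fixes x x' :: "'a::linorder list"
  assumes "length x = length x'"
  shows "x @ y < x' @ y' \<longleftrightarrow> x < x' \<or> x = x' \<and> y < y'"
  using assms by (induction x x' rule: list_induct2) auto

lemma append_le_append_iff:
  fixes x x' :: "'a::linorder list"
  assumes "length x = length x'"
  shows "x @ y \<le> x' @ y' \<longleftrightarrow> x < x' \<or> x = x' \<and> y \<le> y'"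
  using append_less_append_iff[OF assms] assms by (auto simp: le_less)

lemma same_append_less_iff [simp]:
  fixes x :: "'a::linorder list"
  shows "x @ y < x @ y' \<longleftrightarrow> y < y'"
  by (simp add: append_less_append_iff)

lemma same_append_le_iff [simp]:
  fixes x :: "'a::linorder list"
  shows "x @ y \<le> x @ y' \<longleftrightarrow> y \<le> y'"
  by (simp add: append_le_append_iff)

abbreviation zeros :: "nat \<Rightarrow> bool list" where
  "zeros k \<equiv> replicate k False"

abbreviation ones :: "nat \<Rightarrow> bool list" where
  "ones k \<equiv> replicate k True"

text \<open>At position \<open>i\<close> the left side still has a 0 and the right side its first 1.
  Many of the strict comparisons below reduce to this one.\<close>

lemma zeros_less:
  assumes "i < m"
  shows "zeros m @ w < zeros i @ True # t"
proof -
  obtain d where "m = i + Suc d"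
    using assms less_iff_Suc_add by auto
  then have "zeros m = zeros i @ zeros (Suc d)"
    by (simp only: replicate_add)
  then show ?thesis
    by simp
qed

lemma zeros_True_eq_iff [simp]:
  "zeros i @ True # s = zeros j @ True # t \<longleftrightarrow> i = j \<and> s = t"
proof (induction i arbitrary: j)
  case 0
  then show ?case by (cases j) auto
next
  case (Suc i)
  then show ?case by (cases j) auto
qed

lemma split_first_True:
  assumes "True \<in> set xs"
  obtains i t where "xs = zeros i @ True # t"
proof -
  have "\<exists>i t. xs = zeros i @ True # t"
    using assms
  proof (induction xs)
    case (Cons x xs)
    show ?case
    proof (cases x)
      case True
      then show ?thesis by (intro exI[of _ 0]) auto
    next
      case False
      then obtain i t where "xs = zeros i @ True # t"
        using Cons by auto
      then show ?thesis
        using False by (intro exI[of _ "Suc i"]) auto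
    qed
  qed auto
  then show thesis using that by blast
qed

lemma split_last_True:
  assumes "True \<in> set xs"
  obtains t i where "xs = t @ True # zeros i"
proof -
  obtain i t where "rev xs = zeros i @ True # t"
    using split_first_True[of "rev xs"] assms by auto
  then have "xs = rev t @ True # zeros i"
    by (metis append.assoc append_Cons append_Nil rev.simps(2) rev_append rev_replicate rev_rev_ident)
  then show thesis using that by blast
qed

subsection \<open>Asymmetric bracelets\<close>

lemma rotations_iff: "b \<in> rotations a \<longleftrightarrow> (\<exists>x y. a = x @ y \<and> b = y @ x)"
proof
  assume "b \<in> rotations a"
  then obtain k where "b = rotate k a"
    by (auto simp: rotations_def)
  then have "b = drop (k mod length a) a @ take (k mod length a) a"
    by (simp add: rotate_drop_take)
  then show "\<exists>x y. a = x @ y \<and> b = y @ x"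
    by (metis append_take_drop_id)
next
  assume "\<exists>x y. a = x @ y \<and> b = y @ x"
  then show "b \<in> rotations a"
    unfolding rotations_def by (metis (mono_tags, lifting) mem_Collect_eq rotate_append)
qed

text \<open>The rotations of \<open>rev a\<close> are the strings \<open>rev x @ rev y\<close> over
  the splits \<open>a = x @ y\<close>, and equality of \<open>a\<close> with one of them is
  symmetry. So the bracelet inequality and asymmetry merge into one strict inequality.\<close>

lemma asym_bracelets_iff:
  "a \<in> asym_bracelets n \<longleftrightarrow> length a = n \<and> (\<forall>x y. a = x @ y \<longrightarrow> a \<le> y @ x) \<and>
     (\<forall>x y. a = x @ y \<longrightarrow> a < rev x @ rev y)"
proof -
  have rev_rot: "b \<in> rotations (rev a) \<longleftrightarrow> (\<exists>x y. a = x @ y \<and> b = rev x @ rev y)" for b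
    unfolding rotations_iff by (metis rev_append rev_rev_ident)
  have sym: "is_symmetric a \<longleftrightarrow> (\<exists>x y. a = x @ y \<and> a = rev x @ rev y)"
    unfolding is_symmetric_def rotations_iff by (metis rev_append rev_rev_ident)
  have "is_bracelet a \<longleftrightarrow> (\<forall>x y. a = x @ y \<longrightarrow> a \<le> y @ x) \<and>
      (\<forall>x y. a = x @ y \<longrightarrow> a \<le> rev x @ rev y)"
    unfolding is_bracelet_def Ball_def Un_iff rev_rot unfolding rotations_iff by blast
  then show ?thesis
    unfolding asym_bracelets_def sym mem_Collect_eq less_le by blast
qed

lemma asym_length: "a \<in> asym_bracelets n \<Longrightarrow> length a = n"
  by (simp add: asym_bracelets_iff)

lemma asym_rotation_le: "x @ y \<in> asym_bracelets n \<Longrightarrow> x @ y \<le> y @ x"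
  by (simp add: asym_bracelets_iff)

lemma asym_reversal_less: "x @ y \<in> asym_bracelets n \<Longrightarrow> x @ y < rev x @ rev y"
  by (simp add: asym_bracelets_iff)

section \<open>Strings whose initial zero run is the unique longest one\<close>

lemma replicate_eq_appendE:
  assumes "replicate k c = x @ y"
  obtains i j where "k = i + j" "x = replicate i c" "y = replicate j c"
proof
  show "k = length x + length y" using assms by (metis length_append length_replicate)
  have "\<forall>u \<in> set (x @ y). u = c" using assms by (metis in_set_replicate)
  then show "x = replicate (length x) c" "y = replicate (length y) c"
    by (auto intro!: replicate_eqI)
qed

text \<open>The cut lies in the zero block or properly beyond it; a cut at the boundary falls under
  \<open>zeros\<close>, with \<open>j = 0\<close>.\<close>

lemma append_eq_zeros_append_cases:
  assumes "zeros m @ w = x @ y"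
  obtains (zeros) i j where "m = i + j" "x = zeros i" "y = zeros j @ w"
    | (rest) w1 w2 where "w1 \<noteq> []" "w = w1 @ w2" "x = zeros m @ w1" "y = w2"
proof -
  from assms consider (a) us where "zeros m = x @ us" "us @ w = y"
    | (b) us where "zeros m @ us = x" "w = us @ y"
    by (auto simp: append_eq_append_conv2)
  then show thesis
  proof cases
    case a
    then show thesis using zeros by (metis replicate_eq_appendE)
  next
    case b
    then show thesis using zeros[of m 0] rest by (cases "us = []") auto
  qed
qed

text \<open>The first 1 of \<open>c\<close> comes before position \<open>m\<close>, since otherwise
  \<open>c\<close> would begin with a run of \<open>m\<close> zeros.\<close>

lemma zeros_prefix_less:
  assumes "\<nexists>x y. c @ d = x @ zeros m @ y" "True \<in> set c"
  shows "zeros m @ w < c @ e"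
proof -
  obtain i t where it: "c = zeros i @ True # t"
    using split_first_True[OF assms(2)] .
  have "i < m"
  proof (rule ccontr)
    assume "\<not> i < m"
    then have "c @ d = [] @ zeros m @ (zeros (i - m) @ True # t @ d)"
      using it by (simp flip: append_assoc replicate_add)
    then show False using assms(1) by blast
  qed
  then show ?thesis using zeros_less it by simp
qed

text \<open>Every nontrivial cut leaves a rotation with fewer than \<open>m\<close> leading zeros:
  either it splits the block, or the rotation begins with a suffix of \<open>w\<close>, which ends
  in 1 and contains no \<open>m\<close> consecutive zeros.\<close>

lemma zeros_block_le_rotation:
  assumes w: "w \<noteq> []" "hd w" "last w" and no: "\<nexists>x y. w = x @ zeros m @ y"
    and xy: "zeros m @ w = x @ y"
  shows "zeros m @ w \<le> y @ x"
proof (cases rule: append_eq_zeros_append_cases[OF xy])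
  case (1 i j)
  show ?thesis
  proof (cases "i = 0")
    case False
    then have "j < m" using 1 by simp
    then show ?thesis
      using 1 w zeros_less[of j m w "tl w @ zeros i"] by (cases w) auto
  qed (use 1 in auto)
next
  case (2 w1 w2)
  show ?thesis
  proof (cases "w2 = []")
    case False
    then have "True \<in> set w2"
      using w 2 last_in_set[of w2] by simp
    moreover have "\<nexists>x y. w2 @ [] = x @ zeros m @ y"
      using no 2 by (metis append_Nil2 append_assoc)
    ultimately show ?thesis
      using zeros_prefix_less[of w2 "[]" m w x] 2 by simp
  qed (use 2 in auto)
qed

text \<open>Among the reversed rotations only the one cut right after the block,
  \<open>zeros m @ rev w\<close>, again starts with \<open>m\<close> zeros. There
  \<open>w < rev w\<close> decides; all others have a shorter initial run.\<close>

lemma zeros_block_asym: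
  assumes w: "w \<noteq> []" "hd w" "last w" and no: "\<nexists>x y. w = x @ zeros m @ y"
    and less: "w < rev w" and n: "n = m + length w"
  shows "zeros m @ w \<in> asym_bracelets n"
  unfolding asym_bracelets_iff
proof (intro conjI allI impI)
  fix x y assume xy: "zeros m @ w = x @ y"
  show "zeros m @ w \<le> y @ x"
    using zeros_block_le_rotation[OF w no xy] .
  show "zeros m @ w < rev x @ rev y"
  proof (cases rule: append_eq_zeros_append_cases[OF xy])
    case (1 i j)
    show ?thesis
    proof (cases "j = 0")
      case False
      then have "i < m" using 1 by simp
      moreover obtain t where "rev w = True # t"
        using w by (cases w rule: rev_cases) auto
      ultimately show ?thesis
        using 1 zeros_less[of i m w "t @ zeros j"] by simp
    qed (use 1 less in simp)
  next
    case (2 w1 w2)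
    have "True \<in> set w1" using 2 w hd_in_set[of w1] by simp
    moreover have "\<nexists>x y. rev w1 @ [] = x @ zeros m @ y"
    proof
      assume "\<exists>x y. rev w1 @ [] = x @ zeros m @ y"
      then obtain x y where "rev w1 = x @ zeros m @ y" by auto
      then have "w1 = rev y @ zeros m @ rev x"
        by (metis append_assoc rev_append rev_replicate rev_rev_ident)
      then show False using no 2 by auto
    qed
    ultimately show ?thesis
      using zeros_prefix_less[of "rev w1" "[]" m w "zeros m @ rev y"] 2 by simp
  qed
qed (use n in simp)

section \<open>Explicit forms of the three operations\<close>

text \<open>Rotating back shows that every rotation of \<open>a\<close> is one of \<open>b\<close>,
  so minimality of \<open>b\<close> among its own rotations suffices.\<close>

lemma necklace_of_eq:
  assumes "b \<in> rotations a" "\<And>x y. b = x @ y \<Longrightarrow> b \<le> y @ x"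
  shows "necklace_of a = b"
proof -
  have "b \<le> c" if c: "c \<in> rotations a" for c
  proof -
    obtain x y where ab: "a = x @ y" "b = y @ x" using assms(1) by (auto simp: rotations_iff)
    obtain i where "c = rotate i a" using c by (auto simp: rotations_def)
    moreover have "a = rotate (length y) b" using ab by (simp add: rotate_append)
    ultimately have "c \<in> rotations b" by (auto simp: rotations_def rotate_rotate)
    then show ?thesis using assms(2) by (auto simp: rotations_iff)
  qed
  then show ?thesis
    unfolding necklace_of_def using assms(1) by (intro Min_eqI) auto
qed

lemma first_one_eq: "first_one (zeros z @ True # t) = zeros (Suc z) @ t"
proof -
  have "(LEAST i. i < length (zeros z @ True # t) \<and> (zeros z @ True # t) ! i) = z"
    by (rule Least_equality) (auto simp: nth_append not_less[symmetric] split: if_splits)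
  then show ?thesis
    unfolding first_one_def by (simp add: replicate_append_same[symmetric] list_update_append)
qed

lemma last_zero_eq: "last_zero (a @ False # ones j) = a @ True # ones j"
proof -
  have "(GREATEST i. i < length (a @ False # ones j) \<and> \<not> (a @ False # ones j) ! i) = length a"
    by (rule Greatest_equality) (auto simp: nth_append nth_Cons split: if_splits nat.splits)
  then show ?thesis
    unfolding last_zero_def by (simp add: list_update_append)
qed

lemma no_zeros_mono:
  assumes "\<nexists>x y. w = x @ zeros m @ y" "m \<le> m'"
  shows "\<nexists>x y. w = x @ zeros m' @ y"
proof
  assume "\<exists>x y. w = x @ zeros m' @ y"
  then obtain x y where "w = x @ zeros (m + (m' - m)) @ y"
    using assms(2) by auto
  then have "w = x @ zeros m @ (zeros (m' - m) @ y)"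
    by (simp only: replicate_add append_assoc)
  then show False using assms(1) by blast
qed

lemma no_zeros_infix:
  assumes "\<nexists>x y. a = x @ zeros m @ y" "a = s @ w @ t"
  shows "\<nexists>x y. w = x @ zeros m @ y"
  using assms by (metis append_assoc)

text \<open>Flipping the last 1 produces \<open>q + 1\<close> trailing zeros, which cyclically join
  the \<open>z\<close> leading ones. As \<open>w\<close> has no run longer than \<open>z\<close>,
  the rotation starting with the merged run is the necklace.\<close>

lemma last_one_eq:
  assumes w: "w \<noteq> []" "hd w" "last w" and no: "\<nexists>x y. w = x @ zeros (Suc z) @ y"
  shows "last_one (zeros z @ w @ zeros q @ [True]) = zeros (Suc z + q) @ w"
  unfolding last_one_def
proof (rule necklace_of_eq)
  have "zeros (Suc z + q) = zeros q @ [False] @ zeros z"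
    by (metis append_Cons append_Nil append_assoc add.commute replicate_Suc replicate_add replicate_append_same)
  then show "zeros (Suc z + q) @ w \<in> rotations (butlast (zeros z @ w @ zeros q @ [True]) @ [False])"
    unfolding rotations_iff
    by (intro exI[of _ "zeros z @ w"] exI[of _ "zeros q @ [False]"]) (simp add: butlast_append)
  have no': "\<nexists>x y. w = x @ zeros (Suc z + q) @ y"
    by (rule no_zeros_mono[OF no]) simp
  show "zeros (Suc z + q) @ w \<le> y @ x" if "zeros (Suc z + q) @ w = x @ y" for x y
    using zeros_block_le_rotation[OF w no' that] .
qed

section \<open>Normal form of asymmetric bracelets and the effect of flipping the last 0\<close>

text \<open>Rotating a longer zero run to the front would give a smaller rotation.\<close>

lemma asym_no_longer_run:
  assumes "zeros z @ True # t \<in> asym_bracelets n"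
  shows "\<nexists>x y. zeros z @ True # t = x @ zeros (Suc z) @ y"
proof
  assume "\<exists>x y. zeros z @ True # t = x @ zeros (Suc z) @ y"
  then obtain x y where xy: "zeros z @ True # t = x @ zeros (Suc z) @ y" by blast
  then have "zeros z @ True # t \<le> (zeros (Suc z) @ y) @ x"
    using asym_rotation_le assms by metis
  then show False
    using zeros_less[of z "Suc z" "y @ x" t] by (simp add: leD)
qed

text \<open>The last bit is 1, since a trailing 0 would cyclically lengthen the initial run. The
  reversal cut after the leading zeros compares \<open>1 u 1\<close> with its reverse, so
  \<open>u < rev u\<close>; hence \<open>u\<close> is not all zeros, and its outer zero runs can be
  split off.\<close>

lemma asym_normal_form:
  assumes a: "a \<in> asym_bracelets n"
  obtains z p q v where "a = zeros z @ True # zeros p @ v @ zeros q @ [True]"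
    "v \<noteq> []" "hd v" "last v" "zeros p @ v @ zeros q < zeros q @ rev v @ zeros p"
proof -
  have "a < rev a" using asym_reversal_less[of a "[]" n] a by simp
  have "True \<in> set a"
  proof (rule ccontr)
    assume "True \<notin> set a"
    then have "a = zeros (length a)" by (metis (full_types) replicate_eqI)
    then show False using \<open>a < rev a\<close> by (metis rev_replicate less_irrefl)
  qed
  then obtain z t where zt: "a = zeros z @ True # t" by (rule split_first_True)
  then have less: "True # t < rev (True # t)"
    using asym_reversal_less[of "zeros z" "True # t" n] a by simp
  then have "t \<noteq> []" by auto
  moreover have "last t"
  proof (rule ccontr)
    assume "\<not> last t"
    then obtain s where "t = s @ [False]"
      using \<open>t \<noteq> []\<close> by (metis (full_types) append_butlast_last_id)
    then have "zeros z @ True # t \<le> [False] @ zeros z @ True # s"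
      using asym_rotation_le[of "zeros z @ True # s" "[False]" n] a zt by simp
    then show False using zeros_less[of z "Suc z" "True # s" t] by (simp add: leD)
  qed
  ultimately obtain u where u: "t = u @ [True]"
    by (metis (full_types) append_butlast_last_id)
  then have less: "u < rev u"
    using less by (simp add: append_less_append_iff)
  have "True \<in> set u"
  proof (rule ccontr)
    assume "True \<notin> set u"
    then have "u = zeros (length u)" by (metis (full_types) replicate_eqI)
    then show False using less by (metis rev_replicate less_irrefl)
  qed
  then obtain p s where p: "u = zeros p @ True # s" by (rule split_first_True)
  have "True \<in> set (True # s)" by simp
  \<comment> \<open>\<open>s'\<close> may be empty; then \<open>v\<close> is a single 1, both the
    first and the last 1 of \<open>u\<close>.\<close>
  then obtain s' q where q: "True # s = s' @ True # zeros q" by (rule split_last_True)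
  define v where "v = s' @ [True]"
  have "hd (v @ zeros q)" using q v_def by (metis append.assoc append_Cons append_Nil list.sel(1))
  then have "hd v" "last v" "v \<noteq> []" using v_def by (auto simp: hd_append)
  moreover have "u = zeros p @ v @ zeros q" using p q v_def by simp
  moreover have "rev u = zeros q @ rev v @ zeros p" using calculation by simp
  ultimately show thesis
    using that[of z p v q] zt u less by simp
qed

text \<open>
  The palindrome hypothesis excludes exactly the case in which flipping the last 0 produces the
  symmetric string \<open>c 1\<^bsup>s+1+j\<^esup>\<close>.
\<close>

lemma last_zero_asym:
  assumes a: "a @ False # ones j \<in> asym_bracelets n" and hd: "a \<noteq> []" "\<not> hd a"
    and no_pal: "\<And>c s. a = c @ ones s \<Longrightarrow> s < j \<Longrightarrow> rev c \<noteq> c"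
  shows "a @ True # ones j \<in> asym_bracelets n"
proof -
  have pos: "\<exists>i. x = a @ True # ones i \<and> y = ones (j - i) \<and> i \<le> j"
    if us: "True # ones j = us @ y" "us \<noteq> []" "x = a @ us" for x y us
  proof -
    obtain us' where us': "us = True # us'" "ones j = us' @ y"
      using us(1,2) by (metis append_eq_Cons_conv)
    then show ?thesis using us by (auto elim!: replicate_eq_appendE)
  qed
  \<comment> \<open>Since \<open>a\<close> begins with 0, this settles all nontrivial cuts among the
    final 1s.\<close>
  have neg: "a @ s < True # t" for s t
    using hd by (cases a) auto
  show ?thesis
    unfolding asym_bracelets_iff
  proof (intro conjI allI impI)
    fix x y assume xy: "a @ True # ones j = x @ y"
    have "(\<exists>c. a = x @ c \<and> y = c @ True # ones j) \<or>
        (\<exists>i. x = a @ True # ones i \<and> y = ones (j - i) \<and> i \<le> j)"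
    proof -
      from xy consider us where "a = x @ us" "us @ True # ones j = y"
        | us where "us \<noteq> []" "a @ us = x" "True # ones j = us @ y"
        unfolding append_eq_append_conv2 by (metis append_Nil append_Nil2)
      then show ?thesis using pos by cases blast+
    qed
    then consider (a) c where "a = x @ c" "y = c @ True # ones j"
      | (b) i where "x = a @ True # ones i" "y = ones (j - i)" "i \<le> j"
      by blast
    note cases = this
    show "a @ True # ones j \<le> y @ x"
      using cases
    proof cases
      case (a c)
      show ?thesis
      proof (cases "x = []")
        case False
        \<comment> \<open>The prefix \<open>e\<close> faces \<open>c\<close> and the flipped bit of
          the rotation. As \<open>x\<close> is nonempty, \<open>e\<close> lies before the flipped
          bit on the left, so the flip raises only the right side and \<open>e \<le> c0\<close>
          becomes \<open>e < c1\<close>.\<close>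
        define e where "e = take (Suc (length c)) a"
        define d where "d = drop (Suc (length c)) a"
        have ed: "a = e @ d" by (simp add: e_def d_def)
        have "Suc (length c) \<le> length a" using a False by (cases x) auto
        then have le: "length e = Suc (length c)" by (simp add: e_def)
        have "a @ False # ones j \<le> (c @ False # ones j) @ x"
          using asym_rotation_le[of x "c @ False # ones j" n] assms(1) a by simp
        then have "e @ (d @ False # ones j) \<le> (c @ [False]) @ (ones j @ x)"
          using ed by simp
        then have "e \<le> c @ [False]"
          using append_le_append_iff[of e "c @ [False]"] le by auto
        also have "\<dots> < c @ [True]" by simp
        finally have "e @ (d @ True # ones j) < (c @ [True]) @ (ones j @ x)"
          using append_less_append_iff[of e "c @ [True]"] le by auto
        then show ?thesis using ed a by simp
      qed (use a in simp)
    next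
      case (b i)
      show ?thesis
      proof (cases "j - i")
        case 0
        then show ?thesis using b by simp
      next
        case (Suc k)
        then show ?thesis using b neg[of "True # ones j"] by (simp add: less_imp_le)
      qed
    qed
    show "a @ True # ones j < rev x @ rev y"
      using cases
    proof cases
      case (a c)
      have less: "a @ False # ones j < rev x @ ones j @ False # rev c"
        using asym_reversal_less[of x "c @ False # ones j" n] assms(1) a by simp
      show ?thesis
      proof (cases "j < length c")
        case True
        \<comment> \<open>The same argument: the reversed string has its flipped bit at position
          \<open>length x + j\<close>, which is still inside \<open>a\<close>.\<close>
        define e where "e = take (Suc (length x + j)) a"
        define d where "d = drop (Suc (length x + j)) a"
        have ed: "a = e @ d" by (simp add: e_def d_def)
        have le: "length e = Suc (length x + j)"
          using a True by (simp add: e_def)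
        have "e @ (d @ False # ones j) < (rev x @ ones j @ [False]) @ rev c"
          using less ed by simp
        then have "e \<le> rev x @ ones j @ [False]"
          using append_less_append_iff[of e "rev x @ ones j @ [False]"] le by auto
        also have "\<dots> < rev x @ ones j @ [True]" by simp
        finally have "e @ (d @ True # ones j) < (rev x @ ones j @ [True]) @ rev c"
          using append_less_append_iff[of e "rev x @ ones j @ [True]"] le by auto
        then show ?thesis using ed a by simp
      next
        case False
        then obtain k where k: "j = length c + k"
          by (metis le_iff_add not_less)
        have "a @ (False # ones j) < (rev x @ ones (length c)) @ (ones k @ False # rev c)"
          using less k by (simp add: replicate_add)
        then consider "a < rev x @ ones (length c)"
          | "a = rev x @ ones (length c)" "False # ones j < ones k @ False # rev c"
          using append_less_append_iff[of a "rev x @ ones (length c)"] a by auto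
        then show ?thesis
        proof cases
          case 1
          then have "a @ (True # ones j) < (rev x @ ones (length c)) @ (ones k @ True # rev c)"
            using append_less_append_iff[of a "rev x @ ones (length c)"] a by auto
          moreover have "ones (length c) @ ones k = ones j"
            using k by (simp add: replicate_add)
          ultimately show ?thesis
            using a by (metis append_assoc append_Cons append_Nil rev.simps(2) rev_append rev_replicate)
        next
          case 2
          \<comment> \<open>A tie makes \<open>x\<close> a palindrome and \<open>c\<close> all ones.
            The palindrome hypothesis then forces \<open>length c = j\<close>, where the two strings
            of the strict inequality coincide.\<close>
          then have "rev x = x" "c = ones (length c)" using a by auto
          then have "\<not> length c < j" using no_pal[of x "length c"] a by auto
          then have "k = 0" using k by simp
          then have "rev c = ones j"
            using k \<open>c = ones (length c)\<close> by (metis add.right_neutral rev_replicate)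
          then show ?thesis using 2 \<open>k = 0\<close> by simp
        qed
      qed
    next
      case (b i)
      have "rev x @ rev y = ones i @ True # (rev a @ rev y)" using b by simp
      also have "\<dots> = True # (ones i @ rev a @ rev y)"
        by (metis append_Cons append_assoc append_Nil replicate_append_same)
      finally show ?thesis using neg by simp
    qed
  qed (use asym_length[OF a] in simp)
qed

subsection \<open>The three operations\<close>

text \<open>The exponent \<open>z\<close> of the normal form, which measures progress towards the
  root.\<close>

definition leading_zeros :: "bool list \<Rightarrow> nat" where
  "leading_zeros a = length (takeWhile Not a)"

lemma leading_zeros_eq [simp]: "leading_zeros (zeros z @ True # t) = z"
  by (induction z) (simp_all add: leading_zeros_def)

lemma asym_run_le:
  assumes "zeros z @ True # t \<in> asym_bracelets n" "zeros z @ True # t = x @ zeros m @ y"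
  shows "m \<le> z"
proof (rule ccontr)
  assume "\<not> m \<le> z"
  then show False
    using no_zeros_mono[OF asym_no_longer_run[OF assms(1)], of m] assms(2) by auto
qed

text \<open>The condition on \<open>hd (s @ w)\<close> makes \<open>z\<close> the full length of the
  initial run; \<open>s\<close> and \<open>t\<close> are the parts that an operation strips from
  around \<open>w\<close>.\<close>

lemma no_longer_run_in_block:
  assumes "zeros z @ s @ w @ t \<in> asym_bracelets n" "s @ w \<noteq> []" "hd (s @ w)" "z < m"
  shows "\<nexists>x y. w = x @ zeros m @ y"
proof -
  obtain r where r: "s @ w = True # r"
    using assms by (cases "s @ w") auto
  then have "zeros z @ True # (r @ t) \<in> asym_bracelets n"
    using assms(1) by (metis append_Cons append_assoc)
  then have "\<nexists>x y. zeros z @ True # (r @ t) = x @ zeros m @ y"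
    using no_zeros_mono[OF asym_no_longer_run] assms(4) by auto
  moreover have "zeros z @ True # (r @ t) = (zeros z @ s) @ w @ t"
    using r by (metis append_Cons append_assoc)
  ultimately show ?thesis by (rule no_zeros_infix)
qed

lemma first_one_asym:
  assumes a: "zeros z @ True # zeros p @ w \<in> asym_bracelets n"
    and w: "w \<noteq> []" "hd w" "last w" "w < rev w"
  shows "first_one (zeros z @ True # zeros p @ w) \<in> asym_bracelets n"
proof -
  have "\<nexists>x y. w = x @ zeros (Suc z + p) @ y"
    by (rule no_longer_run_in_block[of z "True # zeros p" w "[]" n]) (use a in auto)
  then have "zeros (Suc z + p) @ w \<in> asym_bracelets n"
    using asym_length[OF a] w by (intro zeros_block_asym) auto
  then show ?thesis
    by (simp add: first_one_eq replicate_add)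
qed

lemma last_one_asym:
  assumes a: "zeros z @ w @ zeros q @ [True] \<in> asym_bracelets n"
    and w: "w \<noteq> []" "hd w" "last w" "w < rev w"
  shows "last_one (zeros z @ w @ zeros q @ [True]) \<in> asym_bracelets n"
proof -
  have no: "\<nexists>x y. w = x @ zeros m @ y" if "z < m" for m
    using no_longer_run_in_block[of z "[]" w "zeros q @ [True]" n m] a w that by simp
  have "zeros (Suc z + q) @ w \<in> asym_bracelets n"
    using asym_length[OF a] w no[of "Suc z + q"] by (intro zeros_block_asym) auto
  then show ?thesis
    using last_one_eq[of w z q] w no[of "Suc z"] by simp
qed

text \<open>The flip happens after the first 1, so \<open>z\<close> is kept. The result reads as
  \<open>zeros z\<close>, the block \<open>True # b @ ones j\<close>, an empty zero run and a final
  1; \<open>less\<close> says that this block is below its reverse, as LastOne requires.\<close>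

lemma last_zero_then_last_one_asym:
  assumes a: "zeros z @ True # b @ False # ones j \<in> asym_bracelets n" and "0 < z" "0 < j"
    and no_pal: "\<And>c s. zeros z @ True # b = c @ ones s \<Longrightarrow> s < j \<Longrightarrow> rev c \<noteq> c"
    and less: "True # b @ ones j < ones j @ rev b @ [True]"
  shows "last_zero (zeros z @ True # b @ False # ones j) \<in> asym_bracelets n"
    and "last_one (last_zero (zeros z @ True # b @ False # ones j)) \<in> asym_bracelets n"
    and "leading_zeros (last_zero (zeros z @ True # b @ False # ones j)) = z"
proof -
  let ?a = "zeros z @ True # b"
  have eq: "last_zero (zeros z @ True # b @ False # ones j) = ?a @ True # ones j"
    using last_zero_eq[of ?a j] by simp
  have "?a @ True # ones j \<in> asym_bracelets n"
    using a \<open>0 < z\<close> no_pal by (intro last_zero_asym) (auto simp: hd_append)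
  then show A: "last_zero (zeros z @ True # b @ False # ones j) \<in> asym_bracelets n"
    using eq by simp
  show "leading_zeros (last_zero (zeros z @ True # b @ False # ones j)) = z"
    using eq by simp
  have "?a @ True # ones j = zeros z @ (True # b @ ones j) @ zeros 0 @ [True]"
    by (simp add: replicate_append_same)
  then show "last_one (last_zero (zeros z @ True # b @ False # ones j)) \<in> asym_bracelets n"
    using A eq last_one_asym[of z "True # b @ ones j" 0 n] less \<open>0 < j\<close> by simp
qed

text \<open>A palindrome has equally long initial and final zero runs. This refutes palindromes
  whose final run is known to be shorter than \<open>z\<close>.\<close>

lemma rev_block_eq_zeros:
  assumes "rev (zeros z @ True # b @ v @ zeros q) = zeros z @ True # b @ v @ zeros q"
    "v \<noteq> []" "last v"
  shows "q = z"
proof -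
  obtain v' where "rev v = True # v'"
    using assms(2,3) by (cases v rule: rev_cases) auto
  then show ?thesis using assms(1) by simp
qed

text \<open>The failures of FirstOne and LastOne become the inequalities \<open>F\<close> and
  \<open>L\<close>, which give \<open>q < p\<close>. The last 0 then lies in the run of length
  \<open>q\<close> with one 1 after it, or, when \<open>q = 0\<close>, in the run of length
  \<open>p\<close> or inside \<open>v\<close> with exactly two 1s after it.\<close>

lemma last_zero_step:
  assumes A: "a \<in> asym_bracelets n" and root: "a \<noteq> root_string n"
    and F: "first_one a \<notin> asym_bracelets n" and L: "last_one a \<notin> asym_bracelets n"
  shows "last_zero a \<in> asym_bracelets n \<and> last_one (last_zero a) \<in> asym_bracelets n \<and>
    leading_zeros (last_zero a) = leading_zeros a"
proof -
  obtain z p q v where a: "a = zeros z @ True # zeros p @ v @ zeros q @ [True]"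
    and v: "v \<noteq> []" "hd v" "last v"
    and S: "zeros p @ v @ zeros q < zeros q @ rev v @ zeros p"
    using asym_normal_form[OF A] .
  note A = A[unfolded a]
  obtain v1 where v1: "v = True # v1" using v by (cases v) auto
  obtain v2 where v2: "v = v2 @ [True]" using v by (cases v rule: rev_cases) auto
  have hd_rev: "rev v = True # rev v2" using v2 by simp
  have F: "\<not> v @ zeros q @ [True] < True # zeros q @ rev v"
    using first_one_asym[of z p "v @ zeros q @ [True]" n] A F a v by auto
  have L: "\<not> True # zeros p @ v < rev v @ zeros p @ [True]"
    using last_one_asym[of z "True # zeros p @ v" q n] A L a v by auto
  have "q < p"
  proof (rule ccontr)
    assume "\<not> q < p"
    then consider "p < q" | "p = q" by linarith
    then show False
    proof cases
      case 1
      then show False using S zeros_less[of p q "rev v @ zeros p" "v1 @ zeros q"] v1 by simp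
    next
      case 2
      \<comment> \<open>With \<open>p = q\<close>, the inequalities \<open>S\<close>,
        \<open>L\<close> and \<open>F\<close> close into a strict cycle.\<close>
      then have "v < rev v" using S by (simp add: append_less_append_iff)
      have "rev v @ zeros q @ [True] \<le> True # zeros q @ v"
        using L[unfolded 2] by (simp only: not_less)
      also have "\<dots> < True # zeros q @ rev v"
        using \<open>v < rev v\<close> by simp
      also have "\<dots> \<le> v @ zeros q @ [True]"
        using F by (simp only: not_less)
      also have "\<dots> < rev v @ zeros q @ [True]"
        using \<open>v < rev v\<close> by (simp add: append_less_append_iff)
      finally show False .
    qed
  qed
  have "p \<le> z"
    using asym_run_le[of z _ n "zeros z @ [True]" p] A by simp
  then have "0 < z" using \<open>q < p\<close> by simp
  consider (A) q' where "q = Suc q'" | (B) "q = 0" "v = [True]"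
    | (C) "q = 0" "v2 \<noteq> []"
    using v2 by (cases q) auto
  then show ?thesis
  proof cases
    case A
    define b where "b = zeros p @ v @ zeros q'"
    have eq: "a = zeros z @ True # b @ False # ones 1"
      using a A by (simp add: b_def replicate_app_Cons_same)
    \<comment> \<open>Here \<open>s = 0\<close>, and a palindrome would need \<open>q' = z\<close>,
      while \<open>q' < q < p \<le> z\<close>.\<close>
    have "rev c \<noteq> c" if c: "zeros z @ True # b = c @ ones s" and s: "s < 1" for c s
    proof
      assume "rev c = c"
      then have "rev (zeros z @ True # zeros p @ v @ zeros q') = zeros z @ True # zeros p @ v @ zeros q'"
        using c s b_def by simp
      then have "q' = z" using rev_block_eq_zeros[of z "zeros p" v q'] v by simp
      then show False using A \<open>q < p\<close> \<open>p \<le> z\<close> by simp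
    qed
    \<comment> \<open>After the common first 1, \<open>b\<close> starts with \<open>p\<close> zeros
      and \<open>rev b\<close> with only \<open>q' < p\<close>.\<close>
    moreover have "True # b @ ones 1 < ones 1 @ rev b @ [True]"
      using zeros_less[of q' p "v @ zeros q' @ [True]" "rev v2 @ zeros p @ [True]"] hd_rev A \<open>q < p\<close>
      by (simp add: b_def)
    ultimately show ?thesis
      using last_zero_then_last_one_asym[of z b 1 n] assms(1) \<open>0 < z\<close> unfolding eq by auto
  next
    case B
    obtain p' where p': "p = Suc p'" using \<open>q < p\<close> by (cases p) auto
    have eq: "a = zeros z @ True # zeros p' @ False # ones 2"
      using a B p' by (simp add: replicate_app_Cons_same numeral_2_eq_2)
    \<comment> \<open>For \<open>p = 1\<close> the string is \<open>0^z 1011\<close>; this is where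
      the root is excluded.\<close>
    have "p' \<noteq> 0"
    proof
      assume "p' = 0"
      then have "a = root_string n"
        using eq asym_length[OF assms(1)] by (auto simp: root_string_def numeral_2_eq_2)
      then show False using root by simp
    qed
    \<comment> \<open>The final 0 forces \<open>s = 0\<close>, and a palindrome would need
      \<open>p' = z\<close>, while \<open>p' < p \<le> z\<close>.\<close>
    have "rev c \<noteq> c" if c: "zeros z @ True # zeros p' = c @ ones s" and s: "s < 2" for c s
    proof
      assume pal: "rev c = c"
      obtain p'' where "p' = Suc p''" using \<open>p' \<noteq> 0\<close> by (cases p') auto
      then have "\<not> last (c @ ones s)" unfolding c[symmetric] by simp
      then have "s = 0" by (cases "s = 0") auto
      then have c: "c = zeros z @ True # zeros p'" using c by simp
      then have "rev c = zeros p' @ True # zeros z" by simp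
      then have "p' = z" using pal c zeros_True_eq_iff by metis
      then show False using p' \<open>p \<le> z\<close> by simp
    qed
    moreover have "True # zeros p' @ ones 2 < ones 2 @ rev (zeros p') @ [True]"
      using \<open>p' \<noteq> 0\<close> by (cases p') (auto simp: numeral_2_eq_2)
    ultimately show ?thesis
      using last_zero_then_last_one_asym[of z "zeros p'" 2 n] assms(1) \<open>0 < z\<close> unfolding eq by auto
  next
    case C
    have "True \<in> set v2" using v v2 C by (cases v2) auto
    then obtain u r where ur: "v2 = u @ True # zeros r" by (rule split_last_True)
    define v0 where "v0 = u @ [True]"
    have v0: "v = v0 @ zeros r @ [True]" "v0 \<noteq> []" "last v0" "hd v0"
      using v ur v2 by (auto simp: v0_def hd_append split: if_splits)
    \<comment> \<open>\<open>rev v\<close> begins with \<open>1 0^r 1\<close>, so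
      \<open>r < p\<close> would contradict \<open>L\<close>. In particular \<open>r > 0\<close>, so
      exactly two 1s follow the last 0.\<close>
    have "p \<le> r"
    proof (rule ccontr)
      assume "\<not> p \<le> r"
      then have "zeros p @ v < zeros r @ True # rev u @ zeros p @ [True]"
        by (intro zeros_less) simp
      then show False using L v0 by (simp add: v0_def)
    qed
    have "r \<le> z"
      using asym_run_le[of z _ n "zeros z @ True # zeros p @ v0" r] A v0 by simp
    obtain r' where r': "r = Suc r'" using \<open>p \<le> r\<close> \<open>q < p\<close> by (cases r) auto
    obtain p' where p': "p = Suc p'" using \<open>q < p\<close> by (cases p) auto
    define b where "b = zeros p @ v0 @ zeros r'"
    have eq: "a = zeros z @ True # b @ False # ones 2"
      using a C r' v0 by (simp add: b_def replicate_app_Cons_same numeral_2_eq_2)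
    have "rev c \<noteq> c" if c: "zeros z @ True # b = c @ ones s" and s: "s < 2" for c s
    proof
      assume pal: "rev c = c"
      consider "s = 0" | "s = 1" using s by linarith
      then show False
      proof cases
        case 1
        then have "c = zeros z @ True # zeros p @ v0 @ zeros r'"
          using c b_def by simp
        then have "r' = z"
          using rev_block_eq_zeros[of z "zeros p" v0 r'] v0 pal by metis
        then show False using r' \<open>r \<le> z\<close> by simp
      next
        case 2
        \<comment> \<open>With \<open>s = 1\<close> the string \<open>zeros z @ True # b\<close>
          ends in 1. This leaves \<open>r = p = 1\<close> and \<open>a = c 1011\<close> with the
          palindrome \<open>c = 0^z 1 0 u\<close>.\<close>
        have "r' = 0"
        proof (rule ccontr)
          assume "r' \<noteq> 0"
          then have "\<not> last (zeros z @ True # b)" by (simp add: b_def)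
          then show False using c 2 by simp
        qed
        then have r: "r = 1" "p = 1" using r' p' \<open>p \<le> r\<close> by auto
        have c: "c = zeros z @ True # False # u"
          using c 2 \<open>r' = 0\<close> r by (simp add: b_def v0_def)
        then have c': "c = (rev u @ [False, True]) @ zeros z"
          using pal by (metis append_assoc append_Cons append_Nil rev.simps(2) rev_append rev_replicate)
        \<comment> \<open>\<open>rev u @ [False, True]\<close> is a prefix of \<open>c\<close>
          containing a 1, so it reaches past the initial \<open>0^z 1\<close> of
          \<open>c\<close>.\<close>
        obtain k where k: "rev u @ [False, True] = zeros z @ True # k"
        proof -
          from c c' have "(rev u @ [False, True]) @ zeros z = zeros z @ True # False # u" by simp
          then consider s where "rev u @ [False, True] = zeros z @ s" "s @ zeros z = True # False # u"
            | s where "zeros z = s @ True # False # u"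
            unfolding append_eq_append_conv2[of "rev u @ [False, True]"] by blast
          then show thesis
          proof cases
            case 1
            then show thesis using that \<open>0 < z\<close> by (cases s; cases z) auto
          next
            case 2
            then have "True \<in> set (zeros z)" by simp
            then show thesis by simp
          qed
        qed
        \<comment> \<open>\<open>a\<close> is \<open>0^z 1 0\<close> followed by \<open>?X\<close>.
          Failure of FirstOne bounds \<open>?X\<close> below by \<open>1101 rev u\<close>; a
          rotation bounds it above by a string starting with \<open>11 0^z 1\<close>.\<close>
        let ?X = "u @ [True, False, True, True]"
        have a': "a = c @ [True, False, True, True]"
          using a C v0 r c by (simp add: v0_def)
        have lower: "\<not> ?X < [True, True, False, True] @ rev u"
          using F C v0 r by (simp add: v0_def)
        have "a \<le> (zeros z @ [True, False, True, True]) @ rev u @ [False, True]"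
          using asym_rotation_le[of "rev u @ [False, True]" "zeros z @ [True, False, True, True]" n]
            assms(1) a' c' by simp
        then have "?X \<le> True # True # rev u @ [False, True]"
          using a' c by simp
        then have upper: "?X \<le> True # True # zeros z @ True # k" using k by simp
        \<comment> \<open>For \<open>z \<ge> 2\<close> the two bounds on \<open>?X\<close>
          contradict each other at the fourth bit.\<close>
        have "z = 1"
        proof (rule ccontr)
          assume "z \<noteq> 1"
          then obtain z' where "z = Suc (Suc z')" using \<open>0 < z\<close> by (cases z; cases "z - 1") auto
          then have "True # True # zeros z @ True # k < [True, True, False, True] @ rev u" by simp
          then show False using upper lower by (meson le_less_trans)
        qed
        \<comment> \<open>For \<open>z = 1\<close>, moving \<open>rev u\<close> to the end bounds
          \<open>?X\<close> above by \<open>1011 rev u\<close>, which is below the lower bound at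
          the second bit.\<close>
        then have "a = rev u @ [False, True, False, True, False, True, True]"
          using a' c' by simp
        then have "a \<le> [False, True, False, True, False, True, True] @ rev u"
          using asym_rotation_le assms(1) by metis
        then have "?X \<le> [True, False, True, True] @ rev u"
          using a' c \<open>z = 1\<close> by simp
        moreover have "[True, False, True, True] @ rev u < [True, True, False, True] @ rev u" by simp
        ultimately show False using lower by (meson le_less_trans)
      qed
    qed
    moreover have "True # b @ ones 2 < ones 2 @ rev b @ [True]"
      using p' by (simp add: b_def numeral_2_eq_2)
    ultimately show ?thesis
      using last_zero_then_last_one_asym[of z b 2 n] assms(1) \<open>0 < z\<close> unfolding eq by auto
  qed
qed

section \<open>The initial zero run as a potential\<close>

text \<open>The run absorbs the flipped 1 and the \<open>p\<close> zeros after it.\<close>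

lemma leading_zeros_first_one:
  assumes "a \<in> asym_bracelets n"
  shows "leading_zeros a < leading_zeros (first_one a)"
proof -
  obtain z p q v where a: "a = zeros z @ True # zeros p @ v @ zeros q @ [True]"
    and v: "v \<noteq> []" "hd v" "last v"
    and S: "zeros p @ v @ zeros q < zeros q @ rev v @ zeros p"
    using asym_normal_form[OF assms] .
  obtain v' where "v = True # v'" using v by (cases v) auto
  then have "first_one a = zeros (Suc z + p) @ True # v' @ zeros q @ [True]"
    unfolding a first_one_eq by (simp add: replicate_add)
  then have "leading_zeros (first_one a) = Suc z + p"
    by (simp only: leading_zeros_eq)
  then show ?thesis using a by simp
qed

lemma leading_zeros_last_one:
  assumes "a \<in> asym_bracelets n"
  shows "leading_zeros a < leading_zeros (last_one a)"
proof -
  obtain z p q v where a: "a = zeros z @ True # zeros p @ v @ zeros q @ [True]"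
    and v: "v \<noteq> []" "hd v" "last v"
    and S: "zeros p @ v @ zeros q < zeros q @ rev v @ zeros p"
    using asym_normal_form[OF assms] .
  have "\<nexists>x y. True # zeros p @ v = x @ zeros (Suc z) @ y"
    using assms a
    by (intro no_longer_run_in_block[of z "[]" _ "zeros q @ [True]" n]) auto
  then have "last_one a = zeros (Suc z + q) @ True # zeros p @ v"
    using last_one_eq[of "True # zeros p @ v" z q] a v by simp
  then have "leading_zeros (last_one a) = Suc z + q"
    by (simp only: leading_zeros_eq)
  then show ?thesis using a by simp
qed

text \<open>With \<open>z = 0\<close> there would be no 0 at all, and \<open>ones n\<close> is a
  palindrome. The resulting \<open>z \<ge> 1\<close> sharpens the height bound to
  \<open>2 * (n - 5)\<close>.\<close>

lemma leading_zeros_pos: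
  assumes "a \<in> asym_bracelets n"
  shows "0 < leading_zeros a"
proof (rule ccontr)
  assume zero: "\<not> 0 < leading_zeros a"
  obtain z p q v where a: "a = zeros z @ True # zeros p @ v @ zeros q @ [True]"
    and v: "v \<noteq> []" "hd v" "last v"
    and S: "zeros p @ v @ zeros q < zeros q @ rev v @ zeros p"
    using asym_normal_form[OF assms] .
  then have "z = 0" using zero by simp
  then have no: "\<nexists>x y. a = x @ zeros 1 @ y"
    using asym_no_longer_run[of 0 _ n] assms a by auto
  have "False \<notin> set a"
  proof
    assume "False \<in> set a"
    then obtain x y where "a = x @ zeros 1 @ y" by (auto simp: in_set_conv_decomp)
    then show False using no by blast
  qed
  then have "a = ones (length a)" by (metis (full_types) replicate_eqI)
  then have "rev a = a" by (metis rev_replicate)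
  then show False using asym_reversal_less[of a "[]" n] assms by simp
qed

text \<open>In \<open>0^z 1 u 1\<close> the inequality \<open>u < rev u\<close> needs at least two
  bits, and with two bits only \<open>u = 01\<close> satisfies it, which is the root.\<close>

lemma leading_zeros_less:
  assumes "a \<in> asym_bracelets n" "a \<noteq> root_string n"
  shows "leading_zeros a < n - 4"
proof -
  obtain z p q v where a: "a = zeros z @ True # zeros p @ v @ zeros q @ [True]"
    and v: "v \<noteq> []" "hd v" "last v"
    and S: "zeros p @ v @ zeros q < zeros q @ rev v @ zeros p"
    using asym_normal_form[OF assms(1)] .
  define u where "u = zeros p @ v @ zeros q"
  have u: "u < rev u" using S by (simp add: u_def)
  have a: "a = zeros z @ True # u @ [True]" using a by (simp add: u_def)
  then have n: "n = z + 2 + length u" using asym_length[OF assms(1)] by simp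
  have "length u \<noteq> 0" "length u \<noteq> 1"
    using u by (auto simp: length_Suc_conv)
  moreover have "length u \<noteq> 2"
  proof
    assume "length u = 2"
    then obtain x y where xy: "u = [x, y]" by (auto simp: length_Suc_conv numeral_2_eq_2)
    then have "u = [False, True]" using u by auto
    then show False using a n assms(2) by (simp add: root_string_def)
  qed
  ultimately have "3 \<le> length u" by linarith
  then show ?thesis using a n by simp
qed

text \<open>For \<open>n \<ge> 6\<close> the initial block has length at least 2, whereas
  \<open>1011\<close> has no two adjacent zeros.\<close>

lemma root_string_asym:
  assumes "n \<ge> 6"
  shows "root_string n \<in> asym_bracelets n"
  unfolding root_string_def
proof (rule zeros_block_asym)
  have "\<nexists>x y. [True, False, True, True] = x @ zeros 2 @ y"
    by (auto simp: numeral_2_eq_2 Cons_eq_append_conv)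
  then show "\<nexists>x y. [True, False, True, True] = x @ zeros (n - 4) @ y"
    by (rule no_zeros_mono) (use assms in simp)
qed (use assms in auto)

text \<open>LastZero keeps \<open>z\<close>, but LastOne succeeds on its result, so the next step is
  FirstOne or LastOne and raises \<open>z\<close>. The intermediate string is not the root, since
  its \<open>z\<close> is below \<open>n - 4\<close>.\<close>

lemma par_step:
  assumes a: "a \<in> asym_bracelets n" "a \<noteq> root_string n"
  shows "par n a \<in> asym_bracelets n"
    and "leading_zeros a < leading_zeros (par n a) \<or> par n a \<noteq> root_string n \<and>
      leading_zeros a < leading_zeros (par n (par n a))"
proof -
  show "par n a \<in> asym_bracelets n"
    using last_zero_step[OF a] by (auto simp: par_def)
  show "leading_zeros a < leading_zeros (par n a) \<or> par n a \<noteq> root_string n \<and>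
      leading_zeros a < leading_zeros (par n (par n a))"
  proof (cases "first_one a \<in> asym_bracelets n \<or> last_one a \<in> asym_bracelets n")
    case True
    then show ?thesis
      using leading_zeros_first_one[OF a(1)] leading_zeros_last_one[OF a(1)] by (auto simp: par_def)
  next
    case False
    let ?b = "last_zero a"
    have b: "?b \<in> asym_bracelets n" "last_one ?b \<in> asym_bracelets n"
      "leading_zeros ?b = leading_zeros a"
      using last_zero_step[OF a] False by auto
    have "par n a = ?b" using False by (simp add: par_def)
    moreover have "leading_zeros ?b < leading_zeros (par n ?b)"
      using leading_zeros_first_one[OF b(1)] leading_zeros_last_one[OF b(1)] b(2)
      by (auto simp: par_def)
    moreover have "?b \<noteq> root_string n"
    proof
      assume "?b = root_string n"
      then have "leading_zeros ?b = n - 4" by (simp add: root_string_def)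
      then show False using leading_zeros_less[OF a] b(3) by simp
    qed
    ultimately show ?thesis using b(3) by simp
  qed
qed

text \<open>Each increase of \<open>z\<close> towards \<open>n - 4\<close> costs at most two
  steps.\<close>

lemma par_reaches_root:
  assumes "a \<in> asym_bracelets n"
  shows "\<exists>k \<le> 2 * (n - 4 - leading_zeros a). (par n ^^ k) a = root_string n"
  using assms
proof (induction "n - 4 - leading_zeros a" arbitrary: a rule: less_induct)
  case less
  show ?case
  proof (cases "a = root_string n")
    case True
    then show ?thesis by (intro exI[of _ 0]) simp
  next
    case False
    note lt = leading_zeros_less[OF less.prems False]
    have shift: "(par n ^^ Suc k) a = (par n ^^ k) (par n a)" for k a
      by (simp add: funpow_swap1)
    consider "leading_zeros a < leading_zeros (par n a)"
      | "par n a \<noteq> root_string n" "leading_zeros a < leading_zeros (par n (par n a))"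
      using par_step(2)[OF less.prems False] by blast
    then show ?thesis
    proof cases
      case 1
      then have "n - 4 - leading_zeros (par n a) < n - 4 - leading_zeros a" using lt by simp
      from less.hyps[OF this par_step(1)[OF less.prems False]]
      obtain k where k: "k \<le> 2 * (n - 4 - leading_zeros (par n a))"
        "(par n ^^ k) (par n a) = root_string n" by blast
      have "Suc k \<le> 2 * (n - 4 - leading_zeros a)" using k(1) 1 lt by simp
      moreover have "(par n ^^ Suc k) a = root_string n" using k(2) by (simp only: shift)
      ultimately show ?thesis by blast
    next
      case 2
      then have "n - 4 - leading_zeros (par n (par n a)) < n - 4 - leading_zeros a" using lt by simp
      from less.hyps[OF this par_step(1)[OF par_step(1)[OF less.prems False] 2(1)]]
      obtain k where k: "k \<le> 2 * (n - 4 - leading_zeros (par n (par n a)))"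
        "(par n ^^ k) (par n (par n a)) = root_string n" by blast
      have "Suc (Suc k) \<le> 2 * (n - 4 - leading_zeros a)" using k(1) 2 lt by simp
      moreover have "(par n ^^ Suc (Suc k)) a = root_string n" using k(2) by (simp only: shift)
      ultimately show ?thesis by blast
    qed
  qed
qed

subsection \<open>Trees from parent functions\<close>

lemma walk_betw_rev:
  assumes "walk_betw V E u w v"
  shows "walk_betw V E v (rev w) u"
  using assms unfolding walk_betw_def
  by (auto simp: hd_rev last_rev insert_commute)

lemma walk_betw_append:
  assumes "walk_betw V E u w v" "walk_betw V E v w' x"
  shows "\<exists>w''. walk_betw V E u w'' x"
proof -
  obtain t where t: "w' = v # t"
    using assms(2) by (cases w') (auto simp: walk_betw_def)
  have "walk_betw V E u (w @ t) x"
    using assms t unfolding walk_betw_def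
    by (cases t) (auto simp: successively_append_iff)
  then show ?thesis by blast
qed

text \<open>The iteration may meet \<open>r\<close> before step \<open>k\<close>. The walk stops at
  the first visit, so its length is only bounded by \<open>Suc k\<close>.\<close>

lemma walk_to_root:
  assumes closed: "\<And>x. x \<in> V - {r} \<Longrightarrow> p x \<in> V"
    and "x \<in> V" "(p ^^ k) x = r"
  shows "\<exists>w. walk_betw V {{x, p x} | x. x \<in> V - {r}} x w r \<and> length w \<le> Suc k"
  using assms(2,3)
proof (induction k arbitrary: x)
  case 0
  then show ?case by (intro exI[of _ "[x]"]) (auto simp: walk_betw_def)
next
  case (Suc k)
  show ?case
  proof (cases "x = r")
    case True
    then show ?thesis using Suc.prems by (intro exI[of _ "[x]"]) (auto simp: walk_betw_def)
  next
    case False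
    then have "p x \<in> V" using Suc.prems closed by simp
    moreover have "(p ^^ k) (p x) = r" using Suc.prems by (simp add: funpow_swap1)
    ultimately obtain w where w: "walk_betw V {{x, p x} | x. x \<in> V - {r}} (p x) w r"
      "length w \<le> Suc k" using Suc.IH by blast
    then obtain t where "w = p x # t" by (cases w) (auto simp: walk_betw_def)
    then have "walk_betw V {{x, p x} | x. x \<in> V - {r}} x (x # w) r"
      using w Suc.prems False unfolding walk_betw_def by auto
    then show ?thesis using w by (intro exI[of _ "x # w"]) auto
  qed
qed

text \<open>The depth \<open>d\<close>, the least number of steps to \<open>r\<close>, drops by
  exactly one from a vertex to its parent. Hence there are no loops, and a deepest vertex on a cycle
  would have two distinct neighbours both equal to its parent.\<close>

lemma parent_function_tree:
  assumes fin: "finite V" and r: "r \<in> V" and closed: "\<And>x. x \<in> V - {r} \<Longrightarrow> p x \<in> V"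
    and reach: "\<And>x. x \<in> V \<Longrightarrow> \<exists>k. (p ^^ k) x = r"
  shows "rooted_tree V {{x, p x} | x. x \<in> V - {r}} r"
proof -
  let ?E = "{{x, p x} | x. x \<in> V - {r}}"
  define d where "d x = (LEAST k. (p ^^ k) x = r)" for x
  have d_step: "d x = Suc (d (p x))" if x: "x \<in> V - {r}" for x
  proof -
    obtain k where "(p ^^ k) x = r" using reach x by blast
    then have "(LEAST k. (p ^^ k) x = r) = Suc (LEAST k. (p ^^ Suc k) x = r)"
      by (rule Least_Suc) (use x in simp)
    then show ?thesis by (simp add: d_def funpow_swap1)
  qed
  have "simple_graph V ?E"
    unfolding simple_graph_def
  proof (intro conjI ballI fin)
    fix e assume "e \<in> ?E"
    then obtain x where x: "e = {x, p x}" "x \<in> V - {r}" by blast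
    then have "p x \<noteq> x" using d_step by (metis n_not_Suc_n)
    then show "card e = 2" using x by simp
    show "e \<subseteq> V" using x closed by auto
  qed
  moreover have "connected_graph V ?E"
    unfolding connected_graph_def
  proof (intro conjI ballI)
    fix u v assume "u \<in> V" "v \<in> V"
    have to_root: "\<exists>w. walk_betw V ?E x w r" if x: "x \<in> V" for x
    proof -
      obtain k where "(p ^^ k) x = r" using reach[OF x] by blast
      from walk_to_root[of V r p, OF closed x this] show ?thesis by blast
    qed
    obtain w where w: "walk_betw V ?E u w r" using to_root[OF \<open>u \<in> V\<close>] by blast
    obtain w' where w': "walk_betw V ?E v w' r" using to_root[OF \<open>v \<in> V\<close>] by blast
    show "\<exists>w. walk_betw V ?E u w v" using walk_betw_append[OF w walk_betw_rev[OF w']] .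
  qed (use r in auto)
  moreover have "\<nexists>c. is_cycle V ?E c"
  proof
    assume "\<exists>c. is_cycle V ?E c"
    then obtain c where c: "length c \<ge> 3" "distinct c" "set c \<subseteq> V"
      "successively (\<lambda>x y. {x, y} \<in> ?E) c" "{last c, hd c} \<in> ?E"
      unfolding is_cycle_def by blast
    have edge: "{c ! i, c ! Suc i} \<in> ?E" if "Suc i < length c" for i
      using c(4) that unfolding successively_conv_nth by blast
    have "c \<noteq> []" using c(1) by auto
    then have closing: "{c ! (length c - 1), c ! 0} \<in> ?E"
      using c(5) by (simp add: last_conv_nth hd_conv_nth)
    \<comment> \<open>Both neighbours on the cycle of a vertex of maximal depth must be its parent.\<close>
    have nbr: "y = p x" if xy: "{x, y} \<in> ?E" "d y \<le> d x" for x y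
    proof -
      obtain t where t: "{x, y} = {t, p t}" "t \<in> V - {r}" using xy(1) by blast
      then consider "x = t" "y = p t" | "x = p t" "y = t" by (auto simp: doubleton_eq_iff)
      then show ?thesis using d_step[OF t(2)] xy(2) by cases auto
    qed
    have "\<exists>i < length c. \<forall>j < length c. d (c ! j) \<le> d (c ! i)"
    proof -
      have "Max ((\<lambda>j. d (c ! j)) ` {..<length c}) \<in> (\<lambda>j. d (c ! j)) ` {..<length c}"
        using \<open>c \<noteq> []\<close> by (intro Max_in) auto
      then obtain i where i: "i < length c" "d (c ! i) = Max ((\<lambda>j. d (c ! j)) ` {..<length c})"
        by auto
      then have "d (c ! j) \<le> d (c ! i)" if "j < length c" for j
        using that by auto
      then show ?thesis using i by blast
    qed
    then obtain i where i: "i < length c" "\<And>j. j < length c \<Longrightarrow> d (c ! j) \<le> d (c ! i)"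
      by blast
    \<comment> \<open>\<open>i1\<close> and \<open>i2\<close> are the cyclic successor and
      predecessor of \<open>i\<close>; they differ because the cycle has at least three
      vertices.\<close>
    define i1 where "i1 = (if Suc i < length c then Suc i else 0)"
    define i2 where "i2 = (if i = 0 then length c - 1 else i - 1)"
    have len: "i1 < length c" "i2 < length c" "i1 \<noteq> i2"
      using i(1) c(1) by (auto simp: i1_def i2_def)
    have "{c ! i, c ! i1} \<in> ?E"
    proof (cases "Suc i < length c")
      case False
      then have "i = length c - 1" using i(1) by simp
      then show ?thesis using closing False by (simp add: i1_def)
    qed (use edge in \<open>simp add: i1_def\<close>)
    moreover have "{c ! i, c ! i2} \<in> ?E"
    proof (cases i)
      case 0
      then show ?thesis using closing by (simp add: i2_def insert_commute)
    next
      case (Suc k)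
      then show ?thesis using edge[of k] i(1) by (simp add: i2_def insert_commute)
    qed
    ultimately have "c ! i1 = p (c ! i)" "c ! i2 = p (c ! i)"
      using nbr i(2) len by blast+
    then show False using nth_eq_iff_index_eq[OF c(2) len(1,2)] len(3) by simp
  qed
  ultimately show ?thesis using r by (simp add: rooted_tree_def is_tree_def)
qed

section \<open>The parent tree of the asymmetric bracelets and its height\<close>

theorem theorem2:
  fixes n :: nat
  assumes "n \<ge> 6"
  shows "(\<forall>\<alpha> \<in> asym_bracelets n - {root_string n}. par n \<alpha> \<in> asym_bracelets n) \<and>
         rooted_tree (asym_bracelets n) (par_edges n) (root_string n) \<and>
         (\<forall>\<alpha> \<in> asym_bracelets n. \<exists>k. (par n ^^ k) \<alpha> = root_string n) \<and>
         tree_height (asym_bracelets n) (par_edges n) (root_string n) < 2 * (n - 4)"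
proof -
  let ?V = "asym_bracelets n" and ?r = "root_string n"
  have fin: "finite ?V"
    by (rule finite_subset[OF _ finite_lists_length_eq[of "UNIV :: bool set" n]])
      (auto simp: asym_bracelets_def)
  have r: "?r \<in> ?V" using root_string_asym[OF assms] .
  have closed: "par n a \<in> ?V" if "a \<in> ?V - {?r}" for a
    using par_step(1) that by blast
  have reach: "\<exists>k. (par n ^^ k) a = ?r" if "a \<in> ?V" for a
    using par_reaches_root[OF that] by blast
  have tree: "rooted_tree ?V (par_edges n) ?r"
    unfolding par_edges_def using parent_function_tree[OF fin r closed reach] by simp
  have "graph_dist ?V (par_edges n) ?r a \<le> 2 * (n - 5)" if a: "a \<in> ?V" for a
  proof -
    obtain k where k: "k \<le> 2 * (n - 4 - leading_zeros a)" "(par n ^^ k) a = ?r"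
      using par_reaches_root[OF a] by blast
    obtain w where w: "walk_betw ?V (par_edges n) a w ?r" "length w \<le> Suc k"
      unfolding par_edges_def using walk_to_root[of ?V ?r "par n", OF closed a k(2)] by blast
    then have "0 < length w" by (simp add: walk_betw_def)
    then have "walk_betw ?V (par_edges n) ?r (rev w) a \<and> length (rev w) = (length w - 1) + 1"
      using walk_betw_rev[OF w(1)] by simp
    then have "graph_dist ?V (par_edges n) ?r a \<le> length w - 1"
      unfolding graph_dist_def by (intro Least_le) blast
    also have "\<dots> \<le> 2 * (n - 5)"
      using w(2) k(1) leading_zeros_pos[OF a] by simp
    finally show ?thesis .
  qed
  then have "tree_height ?V (par_edges n) ?r \<le> 2 * (n - 5)"
    unfolding tree_height_def using fin r by (intro Max.boundedI) auto
  \<comment> \<open>Subtraction is truncated, so strictness relies on the lower bound on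
    \<open>n\<close>.\<close>
  then have "tree_height ?V (par_edges n) ?r < 2 * (n - 4)"
    using assms by simp
  then show ?thesis using closed tree reach by blast
qed

end
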